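(* Let $\mathcal{H} = \mathcal{H}_{\mathfrak l}\otimes\mathcal{H}_{\mathfrak w}\otimes\mathcal{H}_{\mathfrak e}$ be the finite-dimensional Hilbert space of a tripartite system with factorized initial state $\rho_0 = \rho_{\mathfrak l}\otimes\rho_{\mathfrak w}\otimes\rho_{\mathfrak e}$, which follows Lindbladian dynamics $$\dot\rho = -\mathrm{i}[H,\rho] + \sum_m\Big(L_m\rho L_m^\dagger - \tfrac12\{L_m^\dagger L_m,\rho\}\Big)$$ with arbitrary Hamiltonian $H = \sum_{ijk} g_{ijk}\,\sigma_i^{\mathfrak l}\otimes\sigma_j^{\mathfrak w}\otimes\sigma_k^{\mathfrak e}$ and noise operators $L_m = \mathbb{1}_{\mathfrak l}\otimes\mathbb{1}_{\mathfrak w}\otimes L_m^{\mathfrak e}$. Then the second time derivative of the purity $\gamma_{\mathfrak l}(\rho) = \mathrm{tr}\big((\mathrm{tr}_{\mathfrak{we}}\rho)^2\big)$ has the following average initial value over all the pure reduced states $\rho_{\mathfrak l}$: $$\langle\ddot\gamma_{\mathfrak l}(\rho)|_{t=0}\rangle_{\mathfrak l} = 4\nu_n\sum_{i>0}\ \sum_{b,c,j,k\ge 0} g_{ibc}\,g_{ijk}\Big(\tau_{c0}\,\tau_{0k}\,\mathrm{tr}(\sigma_b^{\mathfrak w}\rho_{\mathfrak w})\,\mathrm{tr}(\sigma_j^{\mathfrak w}\rho_{\mathfrak w}) - \tau_{ck}\,\mathrm{tr}(\sigma_b^{\mathfrak w}\sigma_j^{\mathfrak w}\rho_{\mathfrak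 w})\Big),$$ where $\nu_n = \frac{1}{n_{\mathfrak l}} - \frac{1}{n_{\mathfrak l}(n_{\mathfrak l}+1)}$ and $\tau_{ck} = \mathrm{tr}(\sigma_c^{\mathfrak e}\sigma_k^{\mathfrak e}\rho_{\mathfrak e})$.
   Context: For $\mathfrak u\in\{\mathfrak l,\mathfrak w,\mathfrak e\}$, $n_{\mathfrak u} = \dim\mathcal{H}_{\mathfrak u}$ and $\{\sigma_i^{\mathfrak u}\}_{i=0}^{n_{\mathfrak u}^2-1}$ is a basis of the space of Hermitian $n_{\mathfrak u}\times n_{\mathfrak u}$ matrices with $\sigma_0^{\mathfrak u} = \mathbb{1}_{\mathfrak u}/\sqrt{n_{\mathfrak u}}$ and $\mathrm{tr}(\sigma_i^{\mathfrak u}\sigma_j^{\mathfrak u}) = \delta_{ij}$ (e.g. Pauli or Gell-Mann matrices together with the identity, normalized to one); $g_{ijk} = \mathrm{tr}\big((\sigma_i^{\mathfrak l}\otimes\sigma_j^{\mathfrak w}\otimes\sigma_k^{\mathfrak e})H\big)$. $\mathrm{tr}_{\mathfrak{we}}$ is the partial trace over $\mathcal{H}_{\mathfrak w}\otimes\mathcal{H}_{\mathfrak e}$. The average $\langle\cdot\rangle_{\mathfrak l}$ is over $\rho_{\mathfrak l}$ uniformly distributed on the set of pure states of $\mathcal{H}_{\mathfrak l}$, with $\rho_{\mathfrak w}$ and $\rho_{\mathfrak e}$ fixed.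
   Formalization: The term τ_{c0}τ_{0k}tr(σ_b^w ρ_w)tr(σ_j^w ρ_w) carries an extra factor n_e = dim H_e, since with σ_0^e = 1/√n_e the printed formula fails for n_e > 1 (three qubits, H = X⊗1⊗1: the purity is constant, but the printed value is −4/3). *)

theory Defs
  imports "HOL-Probability.Probability"
begin

text \<open>Operators on an \<open>n\<close>-dimensional Hilbert space are matrices \<open>complex^'n^'n\<close> with
  \<open>n = CARD('n)\<close>; a tensor product of Hilbert spaces is indexed by the product type.\<close>

type_synonym 'n cmatrix = "complex^'n^'n"

definition cadjoint :: "'n::finite cmatrix \<Rightarrow> 'n cmatrix" where
  "cadjoint A = (\<chi> i j. cnj (A $ j $ i))"

definition hermitian :: "'n::finite cmatrix \<Rightarrow> bool" where
  "hermitian A \<longleftrightarrow> cadjoint A = A"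

definition unitary :: "'n::finite cmatrix \<Rightarrow> bool" where
  "unitary U \<longleftrightarrow> cadjoint U ** U = mat 1 \<and> U ** cadjoint U = mat 1"

definition density_matrix :: "'n::finite cmatrix \<Rightarrow> bool" where
  "density_matrix A \<longleftrightarrow> hermitian A \<and> trace A = 1 \<and>
     (\<forall>v. 0 \<le> Re (\<Sum>i\<in>UNIV. \<Sum>j\<in>UNIV. cnj (v $ i) * A $ i $ j * v $ j))"

definition pure_states :: "'n::finite cmatrix set" where
  "pure_states = {\<chi> i j. \<psi> $ i * cnj (\<psi> $ j) |\<psi>. norm \<psi> = 1}"

text \<open>The uniform distribution on the pure states is the unitarily invariant probability
  measure on them.\<close>

definition uniform_on_pure_states :: "'n::finite cmatrix measure \<Rightarrow> bool" where
  "uniform_on_pure_states \<mu> \<longleftrightarrow>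
     prob_space \<mu> \<and>
     sets \<mu> = sets (restrict_space borel pure_states) \<and>
     (\<forall>U. unitary U \<longrightarrow> distr \<mu> \<mu> (\<lambda>P. U ** P ** cadjoint U) = \<mu>)"

definition kron :: "'a::finite cmatrix \<Rightarrow> 'b::finite cmatrix \<Rightarrow> ('a \<times> 'b) cmatrix"
    (infixr \<open>\<otimes>\<^sub>k\<close> 75) where
  "A \<otimes>\<^sub>k B = (\<chi> p q. A $ fst p $ fst q * B $ snd p $ snd q)"

text \<open>Partial trace over the second tensor factor.\<close>

definition partial_trace :: "('a::finite \<times> 'b::finite) cmatrix \<Rightarrow> 'a cmatrix" where
  "partial_trace A = (\<chi> i j. \<Sum>r\<in>UNIV. A $ (i, r) $ (j, r))"

text \<open>\<open>span\<close> and \<open>independent\<close> are over the reals: the Hermitian matrices form a real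
  vector space of dimension \<open>n\<^sup>2\<close>. Only the values \<open>\<sigma> i\<close> with \<open>i < n\<^sup>2\<close> matter, and they are
  pairwise distinct by the trace condition.\<close>

definition hermitian_basis :: "(nat \<Rightarrow> 'n::finite cmatrix) \<Rightarrow> bool" where
  "hermitian_basis \<sigma> \<longleftrightarrow>
     independent (\<sigma> ` {..<CARD('n)\<^sup>2}) \<and>
     span (\<sigma> ` {..<CARD('n)\<^sup>2}) = {A. hermitian A} \<and>
     \<sigma> 0 = (1 / sqrt (real CARD('n))) *\<^sub>R mat 1 \<and>
     (\<forall>i<CARD('n)\<^sup>2. \<forall>j<CARD('n)\<^sup>2. trace (\<sigma> i ** \<sigma> j) = (if i = j then 1 else 0))"

text \<open>\<open>mat c ** A\<close> is the complex multiple \<open>c A\<close>.\<close>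

definition lindbladian ::
    "'n::finite cmatrix \<Rightarrow> nat \<Rightarrow> (nat \<Rightarrow> 'n cmatrix) \<Rightarrow> 'n cmatrix \<Rightarrow> 'n cmatrix" where
  "lindbladian H M L \<rho> =
     mat (- \<i>) ** (H ** \<rho> - \<rho> ** H) +
     (\<Sum>m<M. L m ** \<rho> ** cadjoint (L m)
        - (1/2) *\<^sub>R (cadjoint (L m) ** L m ** \<rho> + \<rho> ** (cadjoint (L m) ** L m)))"

definition lindblad_solution ::
    "'n::finite cmatrix \<Rightarrow> nat \<Rightarrow> (nat \<Rightarrow> 'n cmatrix) \<Rightarrow> (real \<Rightarrow> 'n cmatrix) \<Rightarrow> bool" where
  "lindblad_solution H M L \<rho> \<longleftrightarrow>
     (\<forall>t\<ge>0. (\<rho> has_vector_derivative lindbladian H M L (\<rho> t)) (at t within {0..}))"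

definition purity :: "('l::finite \<times> 'r::finite) cmatrix \<Rightarrow> complex" where
  "purity \<rho> = trace (partial_trace \<rho> ** partial_trace \<rho>)"

text \<open>Second derivative at the initial time of a function on \<open>t \<ge> 0\<close>.\<close>

definition initial_second_derivative :: "(real \<Rightarrow> complex) \<Rightarrow> complex" where
  "initial_second_derivative f =
     vector_derivative (\<lambda>t. vector_derivative f (at t within {0..})) (at 0 within {0..})"

definition coupling ::
    "(nat \<Rightarrow> 'l::finite cmatrix) \<Rightarrow> (nat \<Rightarrow> 'w::finite cmatrix) \<Rightarrow> (nat \<Rightarrow> 'e::finite cmatrix) \<Rightarrow>
     ('l \<times> 'w \<times> 'e) cmatrix \<Rightarrow> nat \<Rightarrow> nat \<Rightarrow> nat \<Rightarrow> complex" where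
  "coupling \<sigma>l \<sigma>w \<sigma>e H i j k = trace ((\<sigma>l i \<otimes>\<^sub>k \<sigma>w j \<otimes>\<^sub>k \<sigma>e k) ** H)"

text \<open>As \<open>\<sigma> 0 = 1 / sqrt n\<close>, one has \<open>tau \<sigma> \<rho> c 0 = trace (\<sigma> c ** \<rho>) / sqrt n\<close>; hence the product
  of first moments \<open>trace (\<sigma> c ** \<rho>) * trace (\<sigma> k ** \<rho>)\<close> is \<open>n * tau \<sigma> \<rho> c 0 * tau \<sigma> \<rho> 0 k\<close>.\<close>

definition tau :: "(nat \<Rightarrow> 'e::finite cmatrix) \<Rightarrow> 'e cmatrix \<Rightarrow> nat \<Rightarrow> nat \<Rightarrow> complex" where
  "tau \<sigma> \<rho> c k = trace (\<sigma> c ** \<sigma> k ** \<rho>)"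

definition nu :: "nat \<Rightarrow> real" where
  "nu n = 1 / real n - 1 / (real n * (real n + 1))"

end

theory Submission
  imports Defs
begin

text \<open>Write \<open>H = \<Sum>\<^sub>i \<sigma>\<^sub>i \<otimes> G\<^sub>i\<close> with \<open>G\<^sub>i\<close> acting on the two remaining factors, and let
  \<open>X = \<rho>\<^sub>w \<otimes> \<rho>\<^sub>e\<close>. The dissipator acts on the environment only, so it does not contribute to the
  derivative of the reduced state; at second order it only changes \<open>X\<close> in a commutator
  \<open>[h, P]\<close>, which has no overlap with the pure initial state \<open>P\<close>. What is left of the second
  derivative of the purity is
  \<open>4 \<Sum>\<^sub>i\<^sub>j (tr (\<sigma>\<^sub>i \<sigma>\<^sub>j P) - tr (\<sigma>\<^sub>i P \<sigma>\<^sub>j P)) (tr (G\<^sub>i X) tr (G\<^sub>j X) - tr (G\<^sub>i G\<^sub>j X))\<close>.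
  Unitary invariance determines the moments of order at most two of the entries of \<open>P\<close>:
  diagonal phases kill all but the index-matching ones, and \<open>2 \<times> 2\<close> Hadamard rotations fix their
  ratios. The average of the first factor is then \<open>\<nu>\<^sub>n\<close> if \<open>i = j > 0\<close> and 0 otherwise.\<close>

section \<open>Kronecker products and partial traces\<close>

lemma matrix_add_rdistrib:
  fixes A B C :: "'n::finite cmatrix"
  shows "(A + B) ** C = A ** C + B ** C"
  by (simp add: vec_eq_iff matrix_matrix_mult_def distrib_right sum.distrib)

lemma matrix_sum_rdistrib:
  fixes A :: "'i \<Rightarrow> 'n::finite cmatrix" and B :: "'n cmatrix"
  shows "(\<Sum>i\<in>I. A i) ** B = (\<Sum>i\<in>I. A i ** B)"
  by (induction I rule: infinite_finite_induct) (simp_all add: matrix_add_rdistrib)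

lemma matrix_sum_ldistrib:
  fixes A :: "'i \<Rightarrow> 'n::finite cmatrix" and B :: "'n cmatrix"
  shows "B ** (\<Sum>i\<in>I. A i) = (\<Sum>i\<in>I. B ** A i)"
  by (induction I rule: infinite_finite_induct) (simp_all add: matrix_add_ldistrib)

lemma matrix_diff_rdistrib:
  fixes A B C :: "'n::finite cmatrix"
  shows "(A - B) ** C = A ** C - B ** C"
  by (simp add: vec_eq_iff matrix_matrix_mult_def left_diff_distrib sum_subtractf)

lemma matrix_diff_ldistrib:
  fixes A B C :: "'n::finite cmatrix"
  shows "C ** (A - B) = C ** A - C ** B"
  by (simp add: vec_eq_iff matrix_matrix_mult_def right_diff_distrib sum_subtractf)

lemma matrix_scaleR_right:
  fixes A B :: "'n::finite cmatrix"
  shows "A ** (c *\<^sub>R B) = c *\<^sub>R (A ** B)"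
  by (simp add: vec_eq_iff matrix_matrix_mult_def scaleR_sum_right)

lemma matrix_scaleR_left:
  fixes A B :: "'n::finite cmatrix"
  shows "(c *\<^sub>R A) ** B = c *\<^sub>R (A ** B)"
  by (simp add: vec_eq_iff matrix_matrix_mult_def scaleR_sum_right)

section \<open>Complex multiples, written as products with a scalar matrix
  \<open>mat c\<close>\<close>

lemma mat_mult_nth:
  fixes A :: "'n::finite cmatrix"
  shows "(mat c ** A) $ i $ j = c * A $ i $ j"
  by (simp add: matrix_matrix_mult_def mat_def if_distrib if_distribR cong: if_cong)

lemma mult_mat_nth:
  fixes A :: "'n::finite cmatrix"
  shows "(A ** mat c) $ i $ j = c * A $ i $ j"
  by (simp add: matrix_matrix_mult_def mat_def if_distrib if_distribR cong: if_cong)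

lemma mat_mult_comm:
  fixes A :: "'n::finite cmatrix"
  shows "A ** mat c = mat c ** A"
  by (simp add: vec_eq_iff mat_mult_nth mult_mat_nth)

lemma mat_mult_mat: "mat c ** mat d = (mat (c * d) :: 'n::finite cmatrix)"
  by (simp add: vec_eq_iff mat_mult_nth) (simp add: mat_def)

lemma trace_mat_mult:
  fixes A :: "'n::finite cmatrix"
  shows "trace (mat c ** A) = c * trace A"
  by (simp add: trace_def mat_mult_nth sum_distrib_left)

lemma trace_mult_mat_mult:
  fixes A B :: "'n::finite cmatrix"
  shows "trace (B ** (mat c ** A)) = c * trace (B ** A)"
  by (metis mat_mult_comm matrix_mul_assoc trace_mat_mult)

lemma trace_sum: "trace (\<Sum>i\<in>I. A i :: 'n::finite cmatrix) = (\<Sum>i\<in>I. trace (A i))"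
  by (induction I rule: infinite_finite_induct) (simp_all add: trace_add trace_0[unfolded mat_0])

lemma trace_mult_eq_sum:
  fixes A B :: "'n::finite cmatrix"
  shows "trace (A ** B) = (\<Sum>i\<in>UNIV. \<Sum>j\<in>UNIV. A $ i $ j * B $ j $ i)"
  by (simp add: trace_def matrix_matrix_mult_def)

section \<open>Kronecker products\<close>

lemma sum_UNIV_prod:
  "(\<Sum>p\<in>UNIV. f p) = (\<Sum>i\<in>UNIV. \<Sum>j\<in>UNIV. f (i::'a::finite, j::'b::finite))"
  by (simp add: sum.cartesian_product)

lemma kron_mult: "(A \<otimes>\<^sub>k B) ** (C \<otimes>\<^sub>k D) = (A ** C) \<otimes>\<^sub>k (B ** D)"
  by (simp add: vec_eq_iff matrix_matrix_mult_def kron_def sum_UNIV_prod sum_product mult_ac)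

lemma cadjoint_kron: "cadjoint (A \<otimes>\<^sub>k B) = cadjoint A \<otimes>\<^sub>k cadjoint B"
  by (simp add: vec_eq_iff cadjoint_def kron_def)

lemma cadjoint_mat_1: "cadjoint (mat 1) = mat 1"
  by (auto simp: vec_eq_iff cadjoint_def mat_def)

lemma kron_add_right: "A \<otimes>\<^sub>k (B + C) = A \<otimes>\<^sub>k B + A \<otimes>\<^sub>k C"
  by (simp add: vec_eq_iff kron_def distrib_left)

lemma kron_diff_right: "A \<otimes>\<^sub>k (B - C) = A \<otimes>\<^sub>k B - A \<otimes>\<^sub>k C"
  by (simp add: vec_eq_iff kron_def right_diff_distrib)

lemma kron_scaleR_right: "A \<otimes>\<^sub>k (c *\<^sub>R B) = c *\<^sub>R (A \<otimes>\<^sub>k B)"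
  by (simp add: vec_eq_iff kron_def)

lemma kron_zero_right: "A \<otimes>\<^sub>k 0 = 0"
  by (simp add: vec_eq_iff kron_def)

lemma kron_sum_right: "A \<otimes>\<^sub>k (\<Sum>i\<in>I. B i) = (\<Sum>i\<in>I. A \<otimes>\<^sub>k B i)"
  by (induction I rule: infinite_finite_induct) (simp_all add: kron_add_right kron_zero_right)

lemma trace_kron: "trace (A \<otimes>\<^sub>k B) = trace A * trace B"
  by (simp add: trace_def kron_def sum_UNIV_prod sum_product)

section \<open>Partial traces\<close>

lemma partial_trace_add: "partial_trace (A + B) = partial_trace A + partial_trace B"
  by (simp add: vec_eq_iff partial_trace_def sum.distrib)

lemma partial_trace_diff: "partial_trace (A - B) = partial_trace A - partial_trace B"
  by (simp add: vec_eq_iff partial_trace_def sum_subtractf)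

lemma partial_trace_scaleR: "partial_trace (c *\<^sub>R A) = c *\<^sub>R partial_trace A"
  by (simp add: vec_eq_iff partial_trace_def scaleR_sum_right)

lemma partial_trace_zero: "partial_trace 0 = 0"
  by (simp add: vec_eq_iff partial_trace_def)

lemma partial_trace_sum: "partial_trace (\<Sum>i\<in>I. A i) = (\<Sum>i\<in>I. partial_trace (A i))"
  by (induction I rule: infinite_finite_induct)
    (simp_all add: partial_trace_add partial_trace_zero)

lemma partial_trace_mat_mult: "partial_trace (mat c ** A) = mat c ** partial_trace A"
  by (simp add: vec_eq_iff partial_trace_def mat_mult_nth sum_distrib_left)

lemma trace_partial_trace: "trace (partial_trace A) = trace A"
  by (simp add: trace_def partial_trace_def sum_UNIV_prod)

lemma partial_trace_kron: "partial_trace (A \<otimes>\<^sub>k B) = mat (trace B) ** A"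
  by (simp add: vec_eq_iff mat_mult_nth)
    (simp add: partial_trace_def kron_def trace_def sum_distrib_left mult.commute)

lemma kron_mat_1_mult_nth:
  "((A \<otimes>\<^sub>k mat 1) ** Z) $ (i, r) $ q = (\<Sum>k\<in>UNIV. A $ i $ k * Z $ (k, r) $ q)"
  by (simp add: matrix_matrix_mult_def kron_def mat_def sum_UNIV_prod if_distrib if_distribR
      cong: if_cong)

lemma mult_kron_mat_1_nth:
  "(Z ** (A \<otimes>\<^sub>k mat 1)) $ q $ (i, r) = (\<Sum>k\<in>UNIV. Z $ q $ (k, r) * A $ k $ i)"
  by (simp add: matrix_matrix_mult_def kron_def mat_def sum_UNIV_prod if_distrib if_distribR
      cong: if_cong)

text \<open>An operator on the kept factor does not touch the traced index, so it pulls out. With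
  its mirror image this makes the partial trace a bimodule map and reduces identities on the full
  space to identities on the kept factor.\<close>

lemma partial_trace_mult_left: "partial_trace ((A \<otimes>\<^sub>k mat 1) ** Z) = A ** partial_trace Z"
  apply (simp add: vec_eq_iff partial_trace_def kron_mat_1_mult_nth)
  apply (simp add: matrix_matrix_mult_def sum_distrib_left)
  by (intro allI sum.swap)

lemma partial_trace_mult_right: "partial_trace (Z ** (A \<otimes>\<^sub>k mat 1)) = partial_trace Z ** A"
  apply (simp add: vec_eq_iff partial_trace_def mult_kron_mat_1_nth)
  apply (simp add: matrix_matrix_mult_def sum_distrib_right)
  by (intro allI sum.swap)

lemma mat_1_kron_mult_nth:
  "((mat 1 \<otimes>\<^sub>k B) ** Z) $ (i, r) $ q = (\<Sum>s\<in>UNIV. B $ r $ s * Z $ (i, s) $ q)"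
  by (simp add: matrix_matrix_mult_def kron_def mat_def sum_UNIV_prod if_distrib if_distribR
      cong: if_cong) (subst sum.swap, simp)

lemma mult_mat_1_kron_nth:
  "(Z ** (mat 1 \<otimes>\<^sub>k B)) $ q $ (i, r) = (\<Sum>s\<in>UNIV. Z $ q $ (i, s) * B $ s $ r)"
  by (simp add: matrix_matrix_mult_def kron_def mat_def sum_UNIV_prod if_distrib if_distribR
      cong: if_cong) (subst sum.swap, simp)

text \<open>For an operator on the traced factor alone both sides are the same double sum, over the
  traced and the contracted index, in opposite orders.\<close>

lemma partial_trace_cyclic:
  "partial_trace ((mat 1 \<otimes>\<^sub>k B) ** Z) = partial_trace (Z ** (mat 1 \<otimes>\<^sub>k B))"
  unfolding vec_eq_iff partial_trace_def
  by (auto simp: mat_1_kron_mult_nth mult_mat_1_kron_nth mult.commute intro: sum.swap)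

lemmas matrix_distribs =
  matrix_add_ldistrib matrix_add_rdistrib matrix_diff_ldistrib matrix_diff_rdistrib
  matrix_mul_assoc

section \<open>The second derivative of the purity\<close>

definition dissipator ::
    "nat \<Rightarrow> (nat \<Rightarrow> 'n::finite cmatrix) \<Rightarrow> 'n cmatrix \<Rightarrow> 'n cmatrix" where
  "dissipator M L \<rho> = (\<Sum>m<M. L m ** \<rho> ** cadjoint (L m)
     - (1/2) *\<^sub>R (cadjoint (L m) ** L m ** \<rho> + \<rho> ** (cadjoint (L m) ** L m)))"

lemma lindbladian_eq:
  "lindbladian H M L \<rho> = mat (- \<i>) ** (H ** \<rho> - \<rho> ** H) + dissipator M L \<rho>"
  by (simp add: lindbladian_def dissipator_def)

text \<open>By cyclicity in the traced factor the three terms become one partial trace, with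
  coefficients 1, -1/2, -1/2. Arbitrary \<open>Z\<close> is allowed because the second derivative
  applies this to a matrix that is not a product.\<close>

lemma partial_trace_dissipator:
  "partial_trace (dissipator M (\<lambda>m. mat 1 \<otimes>\<^sub>k K m) Z) = 0"
proof -
  have "partial_trace ((mat 1 \<otimes>\<^sub>k B) ** Z ** (mat 1 \<otimes>\<^sub>k C))
      = partial_trace ((mat 1 \<otimes>\<^sub>k (C ** B)) ** Z)" for B C
    using partial_trace_cyclic[of C "(mat 1 \<otimes>\<^sub>k B) ** Z"]
    by (simp add: matrix_mul_assoc kron_mult)
  then show ?thesis
    by (simp add: dissipator_def partial_trace_sum partial_trace_diff partial_trace_scaleR
        partial_trace_add cadjoint_kron cadjoint_mat_1 kron_mult
        flip: partial_trace_cyclic scaleR_2)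
qed

lemma dissipator_kron:
  "dissipator M (\<lambda>m. mat 1 \<otimes>\<^sub>k K m) (A \<otimes>\<^sub>k B) = A \<otimes>\<^sub>k dissipator M K B"
  by (simp add: dissipator_def kron_sum_right kron_diff_right kron_scaleR_right kron_add_right
      cadjoint_kron cadjoint_mat_1 kron_mult)

section \<open>Differentiating the purity along a solution\<close>

lemma linear_lindbladian: "linear (lindbladian H M L)"
proof (rule linearI)
  show "lindbladian H M L (x + y) = lindbladian H M L x + lindbladian H M L y" for x y
    by (simp add: lindbladian_def matrix_distribs algebra_simps flip: sum.distrib)
  show "lindbladian H M L (c *\<^sub>R x) = c *\<^sub>R lindbladian H M L x" for c x
    by (simp add: lindbladian_def matrix_scaleR_left matrix_scaleR_right matrix_diff_ldistrib
        algebra_simps scaleR_sum_right)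
qed

lemma linear_partial_trace: "linear partial_trace"
  by (intro linearI partial_trace_add partial_trace_scaleR)

text \<open>Bilinearity suffices in finite dimension; boundedness supplies the product rule.\<close>

lemma bounded_bilinear_trace_mult:
  "bounded_bilinear (\<lambda>A B::'n::finite cmatrix. trace (A ** B))"
proof -
  have "bilinear (\<lambda>A B::'n::finite cmatrix. trace (A ** B))"
    unfolding bilinear_def trace_mult_eq_sum
    by (auto intro!: linearI simp: algebra_simps sum.distrib scaleR_sum_right)
  then show ?thesis
    by (rule bilinear_conv_bounded_bilinear[THEN iffD1])
qed

text \<open>With \<open>R\<close> the reduced state, the purity is \<open>trace (R ** R)\<close>.
  The product rule applies twice; since the generator is linear and constant in time,
  \<open>R'\<close> and \<open>R''\<close> are the partial traces of one and two applications of
  it.\<close>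

lemma initial_second_derivative_purity_lindblad:
  fixes \<rho> :: "real \<Rightarrow> ('l::finite \<times> 'r::finite) cmatrix"
  assumes sol: "lindblad_solution H M L \<rho>"
  defines "\<Lambda> \<equiv> lindbladian H M L"
  shows "initial_second_derivative (\<lambda>t. purity (\<rho> t)) =
    2 * (trace (partial_trace (\<Lambda> (\<rho> 0)) ** partial_trace (\<Lambda> (\<rho> 0)))
       + trace (partial_trace (\<rho> 0) ** partial_trace (\<Lambda> (\<Lambda> (\<rho> 0)))))"
proof -
  interpret T: bounded_bilinear "\<lambda>A B::'l cmatrix. trace (A ** B)"
    by (rule bounded_bilinear_trace_mult)
  have \<rho>: "(\<rho> has_vector_derivative \<Lambda> (\<rho> t)) (at t within {0..})" if "t \<ge> 0" for t
    using sol that by (simp add: lindblad_solution_def \<Lambda>_def)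
  have pt: "bounded_linear partial_trace" and \<Lambda>: "bounded_linear \<Lambda>"
    by (simp_all add: \<Lambda>_def linear_partial_trace linear_lindbladian flip: linear_conv_bounded_linear)
  note pt\<rho> = bounded_linear.has_vector_derivative[OF pt \<rho>]
  note pt\<Lambda>\<rho> = bounded_linear.has_vector_derivative[OF pt bounded_linear.has_vector_derivative[OF \<Lambda> \<rho>]]
  have D1: "((\<lambda>t. purity (\<rho> t)) has_vector_derivative
      2 * trace (partial_trace (\<rho> t) ** partial_trace (\<Lambda> (\<rho> t)))) (at t within {0..})"
    if "t \<ge> 0" for t
    using T.has_vector_derivative[OF pt\<rho> pt\<rho>, OF that that]
    by (simp add: purity_def trace_mul_sym[of "partial_trace (\<Lambda> (\<rho> t))"])
  \<comment> \<open>A one-sided derivative is unique only at a limit point of the half-line, and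
    only then does \<open>vector_derivative\<close> return it.\<close>
  have nb: "at t within {0..} \<noteq> bot" if "t \<ge> 0" for t :: real
    using that by (auto simp: trivial_limit_within intro!: islimpt_subset[OF islimpt_Icc[THEN iffD2], of t "t+1"])
  have V: "vector_derivative (\<lambda>t. purity (\<rho> t)) (at t within {0..})
      = 2 * trace (partial_trace (\<rho> t) ** partial_trace (\<Lambda> (\<rho> t)))" if "t \<ge> 0" for t
    by (rule vector_derivative_within[OF nb D1]) (use that in auto)
  have "((\<lambda>t. trace (partial_trace (\<rho> t) ** partial_trace (\<Lambda> (\<rho> t)))) has_vector_derivative
      trace (partial_trace (\<rho> 0) ** partial_trace (\<Lambda> (\<Lambda> (\<rho> 0))))
      + trace (partial_trace (\<Lambda> (\<rho> 0)) ** partial_trace (\<Lambda> (\<rho> 0)))) (at 0 within {0..})"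
    using T.has_vector_derivative[OF pt\<rho> pt\<Lambda>\<rho>, OF order_refl order_refl] .
  from has_vector_derivative_mult_right[OF this, of 2]
  \<comment> \<open>The inner derivative is known for nonnegative times only, which is enough
    because the outer one is also taken within the half-line.\<close>
  have D2: "((\<lambda>t. vector_derivative (\<lambda>t. purity (\<rho> t)) (at t within {0..})) has_vector_derivative
      2 * (trace (partial_trace (\<rho> 0) ** partial_trace (\<Lambda> (\<Lambda> (\<rho> 0))))
      + trace (partial_trace (\<Lambda> (\<rho> 0)) ** partial_trace (\<Lambda> (\<rho> 0))))) (at 0 within {0..})"
    by (rule has_vector_derivative_transform[rotated 2]) (simp_all add: V)
  show ?thesis
    unfolding initial_second_derivative_def
    by (subst vector_derivative_within[OF nb D2]) (simp_all add: add.commute)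
qed

text \<open>Factor \<open>P \<otimes>\<^sub>k X\<close> into its two commuting parts and pull
  \<open>P\<close> out; cyclicity in the traced factor identifies the operators left in the two
  terms. It is the mean-field Hamiltonian induced by \<open>X\<close>.\<close>

lemma partial_trace_commutator_kron:
  "partial_trace (H ** (P \<otimes>\<^sub>k X) - (P \<otimes>\<^sub>k X) ** H)
    = partial_trace (H ** (mat 1 \<otimes>\<^sub>k X)) ** P - P ** partial_trace (H ** (mat 1 \<otimes>\<^sub>k X))"
proof -
  have "H ** (P \<otimes>\<^sub>k X) = H ** (mat 1 \<otimes>\<^sub>k X) ** (P \<otimes>\<^sub>k mat 1)"
    by (simp add: kron_mult flip: matrix_mul_assoc)
  moreover have "(P \<otimes>\<^sub>k X) ** H = (P \<otimes>\<^sub>k mat 1) ** ((mat 1 \<otimes>\<^sub>k X) ** H)"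
    by (simp add: kron_mult matrix_mul_assoc)
  ultimately show ?thesis
    by (simp add: partial_trace_diff partial_trace_mult_left partial_trace_mult_right
        partial_trace_cyclic)
qed

text \<open>With \<open>R\<close> the reduced state, the two terms in \<open>h\<close> come from
  \<open>trace (R' ** R')\<close>, where \<open>R'\<close> is \<open>-\<i>\<close> times the
  commutator of \<open>h\<close> and \<open>P\<close>; the two terms in \<open>H\<close> come from
  \<open>trace (R ** R'')\<close>.\<close>

lemma initial_second_derivative_purity:
  assumes sol: "lindblad_solution H M (\<lambda>m. mat 1 \<otimes>\<^sub>k K m) \<rho>"
    and init: "\<rho> 0 = P \<otimes>\<^sub>k X" and P: "P ** P = P" and X: "trace X = 1"
  defines "h \<equiv> partial_trace (H ** (mat 1 \<otimes>\<^sub>k X))"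
  shows "initial_second_derivative (\<lambda>t. purity (\<rho> t)) =
    4 * (trace (h ** h ** P) - trace (h ** P ** h ** P)
       - trace (H ** H ** (P \<otimes>\<^sub>k X)) + trace (H ** (P \<otimes>\<^sub>k X) ** H ** (P \<otimes>\<^sub>k mat 1)))"
proof -
  define \<Lambda> where "\<Lambda> = lindbladian H M (\<lambda>m. mat 1 \<otimes>\<^sub>k K m)"
  define Z where "Z = H ** (P \<otimes>\<^sub>k X) - (P \<otimes>\<^sub>k X) ** H"
  have pt\<Lambda>: "partial_trace (\<Lambda> A) = mat (- \<i>) ** partial_trace (H ** A - A ** H)" for A
    by (simp add: \<Lambda>_def lindbladian_eq partial_trace_add partial_trace_dissipator
        partial_trace_mat_mult)
  have h: "partial_trace Z = h ** P - P ** h"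
    by (simp add: Z_def h_def partial_trace_commutator_kron)
  have R0: "partial_trace (P \<otimes>\<^sub>k X) = P"
    by (simp add: partial_trace_kron X)
  have PX: "(P \<otimes>\<^sub>k X) ** (P \<otimes>\<^sub>k mat 1) = P \<otimes>\<^sub>k X" "(P \<otimes>\<^sub>k mat 1) ** (P \<otimes>\<^sub>k X) = P \<otimes>\<^sub>k X"
    by (simp_all add: kron_mult P)
  have first: "trace (partial_trace (\<Lambda> (P \<otimes>\<^sub>k X)) ** partial_trace (\<Lambda> (P \<otimes>\<^sub>k X)))
      = 2 * (trace (h ** h ** P) - trace (h ** P ** h ** P))"
  proof -
    have "trace (partial_trace (\<Lambda> (P \<otimes>\<^sub>k X)) ** partial_trace (\<Lambda> (P \<otimes>\<^sub>k X)))
        = - trace ((h ** P - P ** h) ** (h ** P - P ** h))"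
      by (simp add: pt\<Lambda> h[unfolded Z_def] trace_mat_mult trace_mult_mat_mult flip: matrix_mul_assoc)
    \<comment> \<open>Idempotence of \<open>P\<close> and cyclicity of the trace make the four terms
      of the squared commutator agree in pairs.\<close>
    moreover have "(h ** P - P ** h) ** (h ** P - P ** h)
        = h ** P ** h ** P - h ** P ** h - P ** h ** h ** P + P ** h ** P ** h"
      using P by (simp add: matrix_distribs matrix_mul_assoc[symmetric, of _ P P])
    moreover have "trace (P ** h ** P ** h) = trace (h ** P ** h ** P)"
      using trace_mul_sym[of P "h ** P ** h"] by (simp add: matrix_mul_assoc)
    moreover have "trace (h ** P ** h) = trace (h ** h ** P)"
      using trace_mul_sym[of "h ** P" h] by (simp add: matrix_mul_assoc)
    moreover have "trace (P ** h ** h ** P) = trace (h ** h ** P)"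
      using trace_mul_sym[of P "h ** h ** P"] P by (simp flip: matrix_mul_assoc)
    ultimately show ?thesis
      by (simp add: trace_add trace_sub)
  qed
  have "trace (P ** partial_trace (\<Lambda> (\<Lambda> (P \<otimes>\<^sub>k X)))) = - \<i> * trace (P **
       partial_trace (H ** \<Lambda> (P \<otimes>\<^sub>k X) - \<Lambda> (P \<otimes>\<^sub>k X) ** H))"
    by (simp add: pt\<Lambda> trace_mult_mat_mult)
  \<comment> \<open>The outer generator has already lost its noise part to the partial trace. The
    inner one keeps it, but it changes only \<open>X\<close>, so the state stays a product
    there.\<close>
  also have "partial_trace (H ** \<Lambda> (P \<otimes>\<^sub>k X) - \<Lambda> (P \<otimes>\<^sub>k X) ** H)
      = mat (- \<i>) ** partial_trace (H ** Z - Z ** H)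
       + partial_trace (H ** (P \<otimes>\<^sub>k dissipator M K X) - (P \<otimes>\<^sub>k dissipator M K X) ** H)"
    by (simp add: \<Lambda>_def lindbladian_eq dissipator_kron matrix_add_ldistrib matrix_add_rdistrib
        matrix_diff_ldistrib partial_trace_add partial_trace_diff mat_mult_comm
        flip: Z_def partial_trace_mat_mult) (simp add: matrix_mul_assoc mat_mult_comm)
  also have "trace (P ** (mat (- \<i>) ** partial_trace (H ** Z - Z ** H)
       + partial_trace (H ** (P \<otimes>\<^sub>k dissipator M K X) - (P \<otimes>\<^sub>k dissipator M K X) ** H)))
      = - \<i> * trace ((P \<otimes>\<^sub>k mat 1) ** (H ** Z - Z ** H))"
  proof -
    \<comment> \<open>The noise enters as a commutator with \<open>P\<close> tested against
      \<open>P\<close> itself, and cyclicity cancels it.\<close>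
    have "trace (P ** (A ** P - P ** A)) = 0" for A
      using trace_mul_sym[of P "A ** P"] trace_mul_sym[of P A]
      by (simp add: matrix_diff_ldistrib trace_sub matrix_mul_assoc P)
        (simp add: P flip: matrix_mul_assoc)
    moreover have "trace (P ** partial_trace A) = trace ((P \<otimes>\<^sub>k mat 1) ** A)" for A :: "('a \<times> 'b) cmatrix"
      by (simp add: trace_partial_trace flip: partial_trace_mult_left)
    ultimately show ?thesis
      by (simp only: partial_trace_commutator_kron matrix_add_ldistrib trace_add
          trace_mult_mat_mult) simp
  qed
  also have "trace ((P \<otimes>\<^sub>k mat 1) ** (H ** Z - Z ** H)) =
      2 * (trace (H ** H ** (P \<otimes>\<^sub>k X)) - trace (H ** (P \<otimes>\<^sub>k X) ** H ** (P \<otimes>\<^sub>k mat 1)))"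
  proof -
    define p x where "p = P \<otimes>\<^sub>k (mat 1 :: 'b cmatrix)" and "x = P \<otimes>\<^sub>k X"
    \<comment> \<open>Since \<open>x\<close> absorbs \<open>p\<close>, the four terms of the double
      commutator collapse to two, each occurring twice.\<close>
    have "x ** p = x" "p ** x = x"
      using PX by (simp_all add: p_def x_def)
    then have "trace (p ** H ** H ** x) = trace (H ** H ** x)"
      "trace (p ** x ** H ** H) = trace (H ** H ** x)"
      "trace (p ** H ** x ** H) = trace (H ** x ** H ** p)"
      using trace_mul_sym[of p "H ** H ** x"] trace_mul_sym[of x "H ** H"]
        trace_mul_sym[of p "H ** x ** H"]
      by (simp_all add: matrix_mul_assoc) (simp flip: matrix_mul_assoc)
    then show ?thesis
      unfolding Z_def p_def[symmetric] x_def[symmetric]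
      by (simp only: matrix_distribs trace_sub) simp
  qed
  finally have second: "trace (P ** partial_trace (\<Lambda> (\<Lambda> (P \<otimes>\<^sub>k X)))) =
    - 2 * (trace (H ** H ** (P \<otimes>\<^sub>k X)) - trace (H ** (P \<otimes>\<^sub>k X) ** H ** (P \<otimes>\<^sub>k mat 1)))"
    by simp
  show ?thesis
    unfolding initial_second_derivative_purity_lindblad[OF sol] init R0
      first[unfolded \<Lambda>_def] second[unfolded \<Lambda>_def]
    by (simp add: algebra_simps)
qed

section \<open>Expansion in Hermitian bases\<close>

lemma mat_mult_mult_mat_mult:
  fixes A B :: "'n::finite cmatrix"
  shows "(mat c ** A) ** (mat d ** B) = mat (c * d) ** (A ** B)"
  by (metis mat_mult_comm mat_mult_mat matrix_mul_assoc)

text \<open>The completeness relation in entries: the sum of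
  \<open>\<sigma> i \<otimes>\<^sub>k \<sigma> i\<close> is the swap operator. In this form it
  passes directly to tensor products, and the free index type admits product index sets.\<close>

definition complete_family :: "'i set \<Rightarrow> ('i \<Rightarrow> 'n::finite cmatrix) \<Rightarrow> bool" where
  "complete_family I \<sigma> \<longleftrightarrow> (\<forall>a b c d. (\<Sum>i\<in>I. \<sigma> i $ a $ b * \<sigma> i $ c $ d) =
     (if a = d \<and> b = c then 1 else 0))"

lemma complete_family_expansion:
  assumes "complete_family I \<sigma>"
  shows "(\<Sum>i\<in>I. mat (trace (\<sigma> i ** A)) ** \<sigma> i) = A"
proof -
  have "(\<Sum>i\<in>I. (\<Sum>c\<in>UNIV. \<Sum>d\<in>UNIV. \<sigma> i $ c $ d * A $ d $ c) * \<sigma> i $ a $ b) = A $ a $ b" for a b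
  proof -
    have "(\<Sum>i\<in>I. (\<Sum>c\<in>UNIV. \<Sum>d\<in>UNIV. \<sigma> i $ c $ d * A $ d $ c) * \<sigma> i $ a $ b)
        = (\<Sum>i\<in>I. \<Sum>c\<in>UNIV. \<Sum>d\<in>UNIV. A $ d $ c * (\<sigma> i $ a $ b * \<sigma> i $ c $ d))"
      by (simp add: sum_distrib_left sum_distrib_right mult_ac)
    also have "\<dots> = (\<Sum>c\<in>UNIV. \<Sum>d\<in>UNIV. A $ d $ c * (\<Sum>i\<in>I. \<sigma> i $ a $ b * \<sigma> i $ c $ d))"
      by (subst sum.swap, rule sum.cong[OF refl], subst sum.swap, simp add: sum_distrib_left)
    also have "\<dots> = (\<Sum>c\<in>UNIV. \<Sum>d\<in>UNIV. if d = a then if c = b then A $ d $ c else 0 else 0)"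
      by (intro sum.cong refl) (use assms in \<open>auto simp: complete_family_def\<close>)
    finally show ?thesis
      by simp
  qed
  then show ?thesis
    by (simp add: vec_eq_iff mat_mult_nth trace_mult_eq_sum)
qed

lemma complete_family_kron:
  assumes "complete_family I \<sigma>" "complete_family J \<tau>"
  shows "complete_family (I \<times> J) (\<lambda>p. \<sigma> (fst p) \<otimes>\<^sub>k \<tau> (snd p))"
proof -
  have "(\<Sum>p\<in>I \<times> J. (\<sigma> (fst p) \<otimes>\<^sub>k \<tau> (snd p)) $ a $ b * (\<sigma> (fst p) \<otimes>\<^sub>k \<tau> (snd p)) $ c $ d)
    = (\<Sum>i\<in>I. \<sigma> i $ fst a $ fst b * \<sigma> i $ fst c $ fst d) *
      (\<Sum>j\<in>J. \<tau> j $ snd a $ snd b * \<tau> j $ snd c $ snd d)" for a b c d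
    by (simp add: sum_product sum.cartesian_product kron_def case_prod_unfold mult_ac)
  then show ?thesis
    using assms by (auto simp: complete_family_def prod_eq_iff)
qed

text \<open>Orthonormality identifies the real coefficients of a Hermitian matrix. Splitting into
  Hermitian and anti-Hermitian parts extends the expansion to all matrices, and matrix units then
  give the relation entrywise.\<close>

lemma hermitian_basis_complete:
  fixes \<sigma> :: "nat \<Rightarrow> 'n::finite cmatrix"
  assumes "hermitian_basis \<sigma>"
  shows "complete_family {..<CARD('n)\<^sup>2} \<sigma>"
proof -
  define I where "I = {..<CARD('n)\<^sup>2}"
  have tr: "trace (\<sigma> i ** \<sigma> j) = (if i = j then 1 else 0)" if "i \<in> I" "j \<in> I" for i j
    using assms that by (simp add: hermitian_basis_def I_def)
  \<comment> \<open>Equal matrices at distinct indices would have overlap 1 and 0 at once;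
    injectivity turns the span of the image into sums over indices.\<close>
  have inj: "inj_on \<sigma> I"
    by (rule inj_onI) (metis tr zero_neq_one)
  have herm: "(\<Sum>i\<in>I. trace (\<sigma> i ** A) * \<sigma> i $ a $ b) = A $ a $ b" if "hermitian A" for A a b
  proof -
    have "A \<in> span (\<sigma> ` I)"
      using assms that by (simp add: hermitian_basis_def I_def)
    then obtain u where "A = (\<Sum>v\<in>\<sigma> ` I. u v *\<^sub>R v)"
      by (subst (asm) span_finite) (auto simp: I_def)
    then have A: "A = (\<Sum>i\<in>I. mat (of_real (u (\<sigma> i))) ** \<sigma> i)"
      by (simp add: sum.reindex[OF inj] vec_eq_iff mat_mult_nth scaleR_conv_of_real[where 'a=complex])
    have "trace (\<sigma> j ** A) = of_real (u (\<sigma> j))" if "j \<in> I" for j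
    proof -
      have "trace (\<sigma> j ** A) = (\<Sum>i\<in>I. of_real (u (\<sigma> i)) * trace (\<sigma> j ** \<sigma> i))"
        by (subst A) (simp add: matrix_sum_ldistrib trace_sum trace_mult_mat_mult)
      also have "\<dots> = (\<Sum>i\<in>I. if j = i then of_real (u (\<sigma> i)) else 0)"
        using that by (intro sum.cong) (auto simp: tr)
      also have "\<dots> = of_real (u (\<sigma> j))"
        using that by (simp add: I_def)
      finally show ?thesis .
    qed
    moreover have "A $ a $ b = (\<Sum>i\<in>I. of_real (u (\<sigma> i)) * \<sigma> i $ a $ b)"
      by (subst A) (simp add: mat_mult_nth)
    ultimately show ?thesis
      by simp
  qed
  have ex: "(\<Sum>i\<in>I. trace (\<sigma> i ** A) * \<sigma> i $ a $ b) = A $ a $ b" for A a b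
  proof -
    define B where "B = mat (1/2) ** (A + cadjoint A)"
    define C where "C = mat (-\<i>/2) ** (A - cadjoint A)"
    have A: "A = B + mat \<i> ** C"
      by (simp add: B_def C_def vec_eq_iff mat_mult_nth field_simps)
    have "hermitian B" "hermitian C"
      by (simp_all add: B_def C_def hermitian_def cadjoint_def vec_eq_iff mat_mult_nth field_simps)
    then show ?thesis
      by (simp add: A matrix_add_ldistrib trace_add trace_mult_mat_mult mat_mult_nth distrib_right
          sum.distrib herm mult.assoc flip: sum_distrib_left)
  qed
  have "(\<Sum>i\<in>I. \<sigma> i $ a $ b * \<sigma> i $ c $ d) = (if a = d \<and> b = c then 1 else 0)" for a b c d
  proof -
    \<comment> \<open>The matrix unit whose overlap with \<open>\<sigma> i\<close> is the entry at
      \<open>a\<close>, \<open>b\<close>.\<close>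
    define E :: "'n cmatrix" where "E = (\<chi> p q. if p = b then if q = a then 1 else 0 else 0)"
    have "trace (\<sigma> i ** E) = \<sigma> i $ a $ b" for i
      by (simp add: trace_mult_eq_sum E_def if_distrib[of "\<lambda>x. _ * x"] cong: if_cong)
    then show ?thesis
      using ex[of E c d] by (auto simp: E_def)
  qed
  then show ?thesis
    by (simp add: complete_family_def I_def)
qed

text \<open>The couplings are the coefficients of \<open>H\<close> in the complete product family;
  grouping by the first index isolates the operators that accompany each
  \<open>\<sigma>l i\<close>.\<close>

lemma kron_expansion:
  assumes "complete_family I \<sigma>l" "complete_family J \<sigma>w" "complete_family K \<sigma>e"
  shows "H = (\<Sum>i\<in>I. \<sigma>l i \<otimes>\<^sub>k (\<Sum>j\<in>J. \<Sum>k\<in>K.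
            mat (coupling \<sigma>l \<sigma>w \<sigma>e H i j k) ** (\<sigma>w j \<otimes>\<^sub>k \<sigma>e k)))"
proof -
  have m: "A \<otimes>\<^sub>k (mat c ** B) = mat c ** (A \<otimes>\<^sub>k B)" for A B c
    by (simp add: vec_eq_iff mat_mult_nth) (simp add: kron_def mat_mult_nth)
  have "complete_family (I \<times> J \<times> K)
     (\<lambda>p. \<sigma>l (fst p) \<otimes>\<^sub>k \<sigma>w (fst (snd p)) \<otimes>\<^sub>k \<sigma>e (snd (snd p)))"
    by (intro complete_family_kron assms)
  from complete_family_expansion[OF this, of H] show ?thesis
    by (simp add: coupling_def kron_sum_right m sum.cartesian_product case_prod_unfold)
qed

text \<open>In the terms with \<open>h\<close> the traced factors enter through products of means,
  in the terms with \<open>H\<close> through means of products. The dependence on \<open>P\<close>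
  is the same in both, so the four double sums combine into one sum of products.\<close>

lemma purity_rate_expansion:
  fixes S :: "'i \<Rightarrow> 'l::finite cmatrix" and G :: "'i \<Rightarrow> 'r::finite cmatrix"
    and P :: "'l cmatrix" and X :: "'r cmatrix"
  assumes H: "H = (\<Sum>i\<in>I. S i \<otimes>\<^sub>k G i)"
  defines "h \<equiv> partial_trace (H ** (mat 1 \<otimes>\<^sub>k X))"
  shows "trace (h ** h ** P) - trace (h ** P ** h ** P)
       - trace (H ** H ** (P \<otimes>\<^sub>k X)) + trace (H ** (P \<otimes>\<^sub>k X) ** H ** (P \<otimes>\<^sub>k mat 1))
    = (\<Sum>i\<in>I. \<Sum>j\<in>I. (trace (S i ** S j ** P) - trace (S i ** P ** S j ** P)) *
        (trace (G i ** X) * trace (G j ** X) - trace (G i ** G j ** X)))"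
proof -
  define x where "x i = trace (G i ** X)" for i
  have h: "h = (\<Sum>i\<in>I. mat (x i) ** S i)"
    by (simp add: h_def H x_def matrix_sum_rdistrib partial_trace_sum kron_mult partial_trace_kron)
  have 1: "trace (h ** h ** P) = (\<Sum>i\<in>I. \<Sum>j\<in>I. x i * x j * trace (S i ** S j ** P))"
    by (simp add: h matrix_sum_ldistrib matrix_sum_rdistrib trace_sum mat_mult_mult_mat_mult
        trace_mat_mult flip: matrix_mul_assoc[of _ _ P]) (simp add: matrix_mul_assoc, rule sum.swap)
  have 2: "trace (h ** P ** h ** P) = (\<Sum>i\<in>I. \<Sum>j\<in>I. x i * x j * trace (S i ** P ** S j ** P))"
  proof -
    have hP: "h ** P = (\<Sum>i\<in>I. mat (x i) ** (S i ** P))"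
      by (simp add: matrix_mul_assoc h matrix_sum_rdistrib)
    have eq: "h ** P ** h ** P = (h ** P) ** (h ** P)"
      by (simp add: matrix_mul_assoc)
    show ?thesis
      unfolding eq unfolding hP
      by (simp add: matrix_sum_ldistrib matrix_sum_rdistrib trace_sum mat_mult_mult_mat_mult
          trace_mat_mult) (simp add: matrix_mul_assoc, rule sum.swap)
  qed
  have 3: "trace (H ** H ** (P \<otimes>\<^sub>k X))
      = (\<Sum>i\<in>I. \<Sum>j\<in>I. trace (S i ** S j ** P) * trace (G i ** G j ** X))"
    by (simp add: H matrix_sum_ldistrib matrix_sum_rdistrib trace_sum kron_mult trace_kron)
      (rule sum.swap)
  have 4: "trace (H ** (P \<otimes>\<^sub>k X) ** H ** (P \<otimes>\<^sub>k mat 1))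
      = (\<Sum>i\<in>I. \<Sum>j\<in>I. trace (S i ** P ** S j ** P) * trace (G i ** G j ** X))"
  proof -
    \<comment> \<open>Cyclicity reverses the order of the two \<open>G\<close> operators; the factor
      in \<open>P\<close> is symmetric in the indices, so relabelling restores the common
      form.\<close>
    have "trace (S i ** P ** S j ** P) = trace (S j ** P ** S i ** P)" for i j
      using trace_mul_sym[of "S i ** P" "S j ** P"] by (simp add: matrix_mul_assoc)
    moreover have "trace (G i ** X ** G j) = trace (G j ** G i ** X)" for i j
      using trace_mul_sym[of "G i ** X" "G j"] by (simp add: matrix_mul_assoc)
    ultimately show ?thesis
      by (simp add: H matrix_sum_ldistrib matrix_sum_rdistrib trace_sum kron_mult trace_kron)
  qed
  show ?thesis
    unfolding 1 2 3 4 x_def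
    by (simp add: algebra_simps sum.distrib sum_subtractf)
qed

section \<open>Moments of the uniform distribution on pure states\<close>

lemma trace_pure_matrix:
  fixes \<psi> :: "complex^'n::finite"
  shows "trace (\<chi> i j. \<psi> $ i * cnj (\<psi> $ j)) = of_real ((norm \<psi>)\<^sup>2)"
  by (simp add: trace_def norm_vec_def L2_set_def sum_nonneg flip: complex_norm_square)

lemma trace_pure_state:
  assumes "P \<in> pure_states"
  shows "trace P = 1"
  using assms by (auto simp: pure_states_def trace_pure_matrix)

text \<open>The vanishing of the 2 by 2 minors, which later becomes a symmetry of the
  moments.\<close>

lemma pure_state_rank_one:
  assumes "P \<in> pure_states"
  shows "P $ i $ j * P $ k $ l = P $ i $ l * P $ k $ j"
  using assms by (auto simp: pure_states_def)

text \<open>Exchanging column indices by the rank one relation turns the double sum into an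
  expectation value times \<open>P\<close>. With \<open>A\<close> the identity this gives
  idempotence.\<close>

lemma pure_state_compress:
  assumes "P \<in> pure_states"
  shows "P ** A ** P = mat (trace (A ** P)) ** P"
proof -
  have "(P ** A ** P) $ i $ j = trace (A ** P) * P $ i $ j" for i j
  proof -
    have "(P ** A ** P) $ i $ j = (\<Sum>k\<in>UNIV. \<Sum>l\<in>UNIV. A $ l $ k * (P $ i $ l * P $ k $ j))"
      by (simp add: matrix_matrix_mult_def sum_distrib_left sum_distrib_right mult_ac)
    also have "\<dots> = (\<Sum>k\<in>UNIV. \<Sum>l\<in>UNIV. A $ l $ k * (P $ k $ l * P $ i $ j))"
      by (subst pure_state_rank_one[OF assms]) (simp add: mult_ac)
    also have "\<dots> = trace (A ** P) * P $ i $ j"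
      by (subst sum.swap) (simp add: trace_mult_eq_sum sum_distrib_left sum_distrib_right mult_ac)
    finally show ?thesis .
  qed
  then show ?thesis
    by (simp add: vec_eq_iff mat_mult_nth)
qed

lemma pure_state_idempotent:
  assumes "P \<in> pure_states"
  shows "P ** P = P"
  using pure_state_compress[OF assms, of "mat 1"] trace_pure_state[OF assms] by simp

lemma norm_pure_state_nth_le:
  assumes "P \<in> pure_states"
  shows "norm (P $ i $ j) \<le> 1"
proof -
  from assms obtain \<psi> where \<psi>: "norm \<psi> = 1" and P: "P = (\<chi> i j. \<psi> $ i * cnj (\<psi> $ j))"
    by (auto simp: pure_states_def)
  have "norm (\<psi> $ k) \<le> 1" for k
    using Finite_Cartesian_Product.norm_nth_le[of \<psi> k] \<psi> by simp
  then show ?thesis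
    by (simp add: P norm_mult mult_le_one)
qed

text \<open>Conjugation replaces the state vector by its image under \<open>U\<close>, whose norm is
  read off from the invariant trace.\<close>

lemma unitary_conj_pure_state:
  assumes "unitary U" "P \<in> pure_states"
  shows "U ** P ** cadjoint U \<in> pure_states"
proof -
  from assms obtain \<psi> where \<psi>: "norm \<psi> = 1" and P: "P = (\<chi> i j. \<psi> $ i * cnj (\<psi> $ j))"
    by (auto simp: pure_states_def)
  have UP: "U ** P ** cadjoint U = (\<chi> i j. (U *v \<psi>) $ i * cnj ((U *v \<psi>) $ j))"
    by (simp add: P vec_eq_iff matrix_matrix_mult_def matrix_vector_mult_def cadjoint_def sum_product
        sum_distrib_right sum_distrib_left mult_ac)
  have "trace (U ** P ** cadjoint U) = 1"
    using trace_mul_sym[of "U ** P" "cadjoint U"] trace_pure_state[OF assms(2)] assms(1)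
    by (simp add: unitary_def matrix_mul_assoc)
  then have "(of_real ((norm (U *v \<psi>))\<^sup>2) :: complex) = of_real 1"
    by (simp only: UP trace_pure_matrix of_real_1)
  then have "(norm (U *v \<psi>))\<^sup>2 = 1"
    by (simp only: of_real_eq_iff)
  then have "norm (U *v \<psi>) = 1"
    using norm_ge_zero[of "U *v \<psi>"] by (auto simp: power2_eq_1_iff)
  then show ?thesis
    unfolding UP by (auto simp: pure_states_def)
qed

section \<open>Moments of matrix entries under the invariant measure\<close>

locale uniform_pure_states =
  fixes \<mu> :: "'n::finite cmatrix measure"
  assumes uniform: "uniform_on_pure_states \<mu>"
begin

sublocale prob_space \<mu>
  using uniform by (simp add: uniform_on_pure_states_def)

lemma sets_eq: "sets \<mu> = sets (restrict_space borel pure_states)"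
  using uniform by (simp add: uniform_on_pure_states_def)

lemma space_eq: "space \<mu> = pure_states"
  using sets_eq_imp_space_eq[OF sets_eq] by (simp add: space_restrict_space)

lemma measurable_nth [measurable]: "(\<lambda>P. P $ i $ j) \<in> borel_measurable \<mu>"
proof -
  have "(\<lambda>P::'n cmatrix. P $ i $ j) \<in> borel_measurable borel"
    by (intro borel_measurable_continuous_onI continuous_intros)
  then show ?thesis
    unfolding measurable_cong_sets[OF sets_eq refl] by (rule measurable_restrict_space1)
qed

lemma integrable_nth_mult: "integrable \<mu> (\<lambda>P. P $ i $ j * P $ k $ l)"
  by (rule integrable_const_bound[where B=1])
    (auto simp: space_eq norm_mult intro!: mult_le_one norm_pure_state_nth_le)

lemma integrable_nth: "integrable \<mu> (\<lambda>P. P $ i $ j)"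
  by (rule integrable_const_bound[where B=1])
    (auto simp: space_eq intro!: norm_pure_state_nth_le)

definition moment :: "'n \<Rightarrow> 'n \<Rightarrow> 'n \<Rightarrow> 'n \<Rightarrow> complex" where
  "moment i j k l = (\<integral>P. P $ i $ j * P $ k $ l \<partial>\<mu>)"

text \<open>Change of variables. Conjugation is continuous and preserves the pure states, hence is
  measurable for the restricted Borel sets.\<close>

lemma moment_unitary:
  assumes "unitary U"
  shows "moment i j k l =
    (\<integral>P. (U ** P ** cadjoint U) $ i $ j * (U ** P ** cadjoint U) $ k $ l \<partial>\<mu>)"
proof -
  let ?T = "\<lambda>P. U ** P ** cadjoint U"
  have "linear ?T"
    by (intro linearI)
      (simp_all add: matrix_add_ldistrib matrix_add_rdistrib matrix_scaleR_left matrix_scaleR_right)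
  then have "?T \<in> measurable borel borel"
    by (intro borel_measurable_continuous_onI linear_continuous_on)
      (simp add: linear_conv_bounded_linear)
  then have "?T \<in> measurable \<mu> \<mu>"
    unfolding measurable_cong_sets[OF sets_eq sets_eq]
    by (rule measurable_restrict_space3) (auto intro: unitary_conj_pure_state[OF assms])
  then have "(\<integral>P. P $ i $ j * P $ k $ l \<partial>distr \<mu> \<mu> ?T) = (\<integral>P. ?T P $ i $ j * ?T P $ k $ l \<partial>\<mu>)"
    by (rule integral_distr) measurable
  moreover have "distr \<mu> \<mu> ?T = \<mu>"
    using uniform assms by (simp add: uniform_on_pure_states_def)
  ultimately show ?thesis
    by (simp add: moment_def)
qed

lemma moment_swap: "moment i j k l = moment i l k j"
  unfolding moment_def
  by (rule Bochner_Integration.integral_cong[OF refl], rule pure_state_rank_one) (simp add: space_eq)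

lemma moment_commute: "moment i j k l = moment k l i j"
  by (simp add: moment_def mult.commute)

text \<open>A diagonal phase multiplies the moment by a number, which invariance forces to be 1 if
  the moment is nonzero. Phases on single basis vectors then match the row indices with the column
  indices as multisets.\<close>

lemma moment_eq_0:
  assumes "\<not> (i = j \<and> k = l)" "\<not> (i = l \<and> k = j)"
  shows "moment i j k l = 0"
proof (rule ccontr)
  assume nz: "moment i j k l \<noteq> 0"
  \<comment> \<open>An index may occur up to twice more among rows than among columns. The phase
    \<open>\<i>\<close> detects a difference of one or two, while -1 would miss two.\<close>
  define d where "d a b = (if b = a then \<i> else 1)" for a b :: 'n
  have 1: "d a i * cnj (d a j) * (d a k * cnj (d a l)) = 1" for a
  proof -
    define D :: "'n cmatrix" where "D = (\<chi> p q. if p = q then d a p else 0)"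
    have D': "cadjoint D = (\<chi> p q. if p = q then cnj (d a p) else 0)"
      by (auto simp: D_def cadjoint_def vec_eq_iff)
    have left: "(D ** Z) $ p $ q = d a p * Z $ p $ q" for Z p q
      by (simp add: D_def matrix_matrix_mult_def if_distrib[of "\<lambda>x. x * _"] cong: if_cong)
    have right: "(Z ** cadjoint D) $ p $ q = Z $ p $ q * cnj (d a q)" for Z p q
      by (simp add: D' matrix_matrix_mult_def if_distrib[of "\<lambda>x. _ * x"] cong: if_cong)
    have "D ** cadjoint D = mat 1"
      unfolding vec_eq_iff right by (simp add: D_def mat_def d_def)
    then have "unitary D"
      by (simp add: unitary_def matrix_left_right_inverse)
    from moment_unitary[OF this, of i j k l]
    have "moment i j k l = (\<integral>P. (d a i * cnj (d a j) * (d a k * cnj (d a l))) * (P $ i $ j * P $ k $ l) \<partial>\<mu>)"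
      by (simp add: left right mult_ac)
    also have "\<dots> = (d a i * cnj (d a j) * (d a k * cnj (d a l))) * moment i j k l"
      by (simp add: moment_def)
    finally show ?thesis
      using nz by simp
  qed
  show False
    using 1[of i] 1[of j] 1[of k] 1[of l] assms
    by (auto simp: d_def complex_eq_iff split: if_splits)
qed

text \<open>A Hadamard rotation in the plane of \<open>i\<close> and \<open>k\<close> sends both
  diagonal moments to the same expression. The two equations thus give equality of the diagonal
  moments and their ratio to the mixed one.\<close>

lemma moment_hadamard:
  assumes ik: "i \<noteq> k"
  shows "moment i i i i = (moment i i i i + moment k k k k + 4 * moment i i k k) / 4"
    and "moment k k k k = (moment i i i i + moment k k k k + 4 * moment i i k k) / 4"
proof -
  define s :: complex where "s = of_real (1 / sqrt 2)"
  have s: "s * s = 1 / 2"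
    by (simp add: s_def flip: of_real_mult)
  define U :: "'n cmatrix" where "U = (\<chi> p q.
    if p = i then s * ((if q = i then 1 else 0) + (if q = k then 1 else 0))
    else if p = k then s * ((if q = i then 1 else 0) - (if q = k then 1 else 0))
    else if q = p then 1 else 0)"
  have row: "(U ** Z) $ p $ q = (if p = i then s * (Z $ i $ q + Z $ k $ q)
      else if p = k then s * (Z $ i $ q - Z $ k $ q) else Z $ p $ q)" for Z p q
    by (simp add: U_def matrix_matrix_mult_def algebra_simps sum.distrib sum_subtractf if_distribR
        if_distrib[of "\<lambda>x. _ * x"] if_distrib[of "\<lambda>x. x * _"] cong: if_cong flip: sum_distrib_left)
  have sym: "U $ p $ q = U $ q $ p" for p q
    using ik by (auto simp: U_def)
  have cnj: "cadjoint U = U"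
    using sym by (simp add: cadjoint_def vec_eq_iff) (auto simp: U_def s_def)
  have col: "(Z ** U) $ q $ p = (if p = i then s * (Z $ q $ i + Z $ q $ k)
      else if p = k then s * (Z $ q $ i - Z $ q $ k) else Z $ q $ p)" for Z p q
  proof -
    have "(Z ** U) $ q $ p = (U ** transpose Z) $ p $ q"
      by (simp add: matrix_matrix_mult_def transpose_def sym mult.commute)
    then show ?thesis
      by (simp add: row transpose_def)
  qed
  have "U ** U = mat 1"
    unfolding vec_eq_iff row using ik s by (auto simp: U_def mat_def algebra_simps)
  then have U: "unitary U"
    by (simp add: unitary_def cnj)
  have ii: "(U ** P ** cadjoint U) $ i $ i = (P $ i $ i + P $ i $ k + P $ k $ i + P $ k $ k) / 2"
    and kk: "(U ** P ** cadjoint U) $ k $ k = (P $ i $ i - P $ i $ k - P $ k $ i + P $ k $ k) / 2" for P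
  proof -
    have "(U ** P ** cadjoint U) $ i $ i = (s * s) * (P $ i $ i + P $ i $ k + P $ k $ i + P $ k $ k)"
      "(U ** P ** cadjoint U) $ k $ k = (s * s) * (P $ i $ i - P $ i $ k - P $ k $ i + P $ k $ k)"
      using ik by (simp_all add: cnj col row algebra_simps)
    then show "(U ** P ** cadjoint U) $ i $ i = (P $ i $ i + P $ i $ k + P $ k $ i + P $ k $ k) / 2"
      "(U ** P ** cadjoint U) $ k $ k = (P $ i $ i - P $ i $ k - P $ k $ i + P $ k $ k) / 2"
      by (simp_all add: s)
  qed
  \<comment> \<open>The sign \<open>c\<close> treats both rows of the rotation at once. Of the
    sixteen products only those with matching indices survive: two diagonal ones and four equal to
    \<open>moment i i k k\<close> by the swap and commutation symmetries.\<close>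
  have quad: "(\<integral>P. (P $ i $ i + c * P $ i $ k + c * P $ k $ i + P $ k $ k) / 2 *
          ((P $ i $ i + c * P $ i $ k + c * P $ k $ i + P $ k $ k) / 2) \<partial>\<mu>)
      = (moment i i i i + moment k k k k + 4 * moment i i k k) / 4" if c: "c * c = 1" for c
  proof -
    have "(\<integral>P. (P $ i $ i + c * P $ i $ k + c * P $ k $ i + P $ k $ k) / 2 *
          ((P $ i $ i + c * P $ i $ k + c * P $ k $ i + P $ k $ k) / 2) \<partial>\<mu>)
      = (\<integral>P. (P $ i $ i * P $ i $ i + c * (P $ i $ i * P $ i $ k) + c * (P $ i $ i * P $ k $ i)
           + P $ i $ i * P $ k $ k
        + c * (P $ i $ k * P $ i $ i) + (c * c) * (P $ i $ k * P $ i $ k)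
           + (c * c) * (P $ i $ k * P $ k $ i) + c * (P $ i $ k * P $ k $ k)
        + c * (P $ k $ i * P $ i $ i) + (c * c) * (P $ k $ i * P $ i $ k)
           + (c * c) * (P $ k $ i * P $ k $ i) + c * (P $ k $ i * P $ k $ k)
        + P $ k $ k * P $ i $ i + c * (P $ k $ k * P $ i $ k) + c * (P $ k $ k * P $ k $ i)
           + P $ k $ k * P $ k $ k) / 4 \<partial>\<mu>)"
      by (rule Bochner_Integration.integral_cong) (simp_all add: field_simps)
    also have "\<dots> = (moment i i i i + c * moment i i i k + c * moment i i k i + moment i i k k
        + c * moment i k i i + (c * c) * moment i k i k + (c * c) * moment i k k i + c * moment i k k k
        + c * moment k i i i + (c * c) * moment k i i k + (c * c) * moment k i k i + c * moment k i k k
        + moment k k i i + c * moment k k i k + c * moment k k k i + moment k k k k) / 4"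
      by (simp add: moment_def integrable_nth_mult mult_ac)
    also have "\<dots> = (moment i i i i + moment k k k k + 4 * moment i i k k) / 4"
      using ik by (simp add: moment_eq_0 c moment_swap[of i k k i] moment_swap[of k i i k]
          moment_commute[of k k i i])
    finally show ?thesis .
  qed
  show "moment i i i i = (moment i i i i + moment k k k k + 4 * moment i i k k) / 4"
    by (subst moment_unitary[OF U]) (use quad[of 1] in \<open>simp add: ii\<close>)
  show "moment k k k k = (moment i i i i + moment k k k k + 4 * moment i i k k) / 4"
    by (subst moment_unitary[OF U]) (use quad[of "-1"] in \<open>simp add: kk\<close>)
qed

lemma sum_moment: "(\<Sum>k\<in>UNIV. moment i j k k) = (\<integral>P. P $ i $ j \<partial>\<mu>)"
proof -
  have "(\<Sum>k\<in>UNIV. moment i j k k) = (\<integral>P. P $ i $ j * trace P \<partial>\<mu>)"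
    by (simp add: moment_def trace_def sum_distrib_left integrable_nth_mult)
  also have "\<dots> = (\<integral>P. P $ i $ j \<partial>\<mu>)"
    by (rule Bochner_Integration.integral_cong) (auto simp: space_eq trace_pure_state)
  finally show ?thesis .
qed

text \<open>The average of \<open>P \<otimes>\<^sub>k P\<close> is the normalized projector onto the
  symmetric subspace. All diagonal moments equal some \<open>a\<close>, mixed ones are
  \<open>a / 2\<close>, and unit trace fixes \<open>a\<close>.\<close>

lemma moment_eq:
  "moment i j k l = ((if i = j \<and> k = l then 1 else 0) + (if i = l \<and> k = j then 1 else 0)) /
     (of_nat CARD('n) * (of_nat CARD('n) + 1))"
proof -
  let ?N = "of_nat CARD('n) :: complex"
  define a where "a = moment i i i i"
  have diag: "moment p p p p = a" for p
  proof (cases "p = i")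
    case False
    show ?thesis
      unfolding a_def by (rule trans[OF moment_hadamard(1)[OF False] moment_hadamard(2)[OF False, symmetric]])
  qed (simp add: a_def)
  \<comment> \<open>Half of \<open>a\<close> everywhere plus another half on the diagonal: over all
    pairs this sums to \<open>a / 2\<close> times N(N+1).\<close>
  have pair: "moment p p q q = (if p = q then a else 0) / 2 + a / 2" for p q
  proof (cases "p = q")
    case False
    have "a = (a + a + 4 * moment p p q q) / 4"
      using moment_hadamard(1)[OF False] unfolding diag .
    then have "4 * moment p p q q = 2 * a"
      by (simp add: eq_divide_eq)
    then show ?thesis
      using False by (simp add: mult.commute)
  qed (simp add: diag)
  have "(\<Sum>p\<in>UNIV. \<Sum>q\<in>UNIV. moment p p q q) = 1"
  proof -
    have "(\<Sum>p\<in>UNIV. \<Sum>q\<in>UNIV. moment p p q q) = (\<integral>P. trace P \<partial>\<mu>)"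
      by (simp add: sum_moment trace_def integrable_nth)
    also have "\<dots> = (\<integral>P. 1 \<partial>\<mu>)"
      by (rule Bochner_Integration.integral_cong) (auto simp: space_eq trace_pure_state)
    finally show ?thesis
      by (simp add: prob_space)
  qed
  moreover have "(\<Sum>p\<in>UNIV. \<Sum>q\<in>UNIV. moment p p q q) = a / 2 * (?N * (?N + 1))"
    by (simp add: pair sum.distrib algebra_simps flip: sum_divide_distrib)
  ultimately have "a / 2 * (?N * (?N + 1)) = 1"
    by simp
  then have a: "a / 2 = 1 / (?N * (?N + 1))"
    by (metis div_by_1 divide_divide_eq_right eq_divide_imp mult_eq_0_iff zero_neq_one)
  have "moment i j k l = ((if i = j \<and> k = l then 1 else 0) + (if i = l \<and> k = j then 1 else 0)) * (a / 2)"
  proof (cases "i = l \<and> k = j")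
    case True
    \<comment> \<open>The rank one symmetry reduces the crossed pattern to the parallel one; when
      all indices coincide both indicators count and give 2.\<close>
    then have "moment i j k l = moment i i k k"
      by (metis moment_swap)
    then have "moment i j k l = (if i = k then a else 0) / 2 + a / 2"
      by (simp only: pair)
    moreover have "(i = j \<and> k = l) = (i = k)"
      using True by blast
    ultimately show ?thesis
      using True by (simp only:) simp
  next
    case False
    show ?thesis
    proof (cases "i = j \<and> k = l")
      case True
      with False have "i \<noteq> k"
        by blast
      have "moment i j k l = moment i i k k"
        using True by simp
      also have "\<dots> = a / 2"
        unfolding pair using \<open>i \<noteq> k\<close> by simp
      finally show ?thesis
        by (simp only: if_P[OF True] if_not_P[OF False]) simp
    next
      case no: False
      show ?thesis
        by (simp only: moment_eq_0[OF no False] if_not_P[OF no] if_not_P[OF False]) simp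
    qed
  qed
  then show ?thesis
    by (simp add: a)
qed

section \<open>Averages of traces\<close>

lemma integral_trace_mult: "(\<integral>P. trace (A ** P) \<partial>\<mu>) = trace A / of_nat CARD('n)"
proof -
  let ?N = "of_nat CARD('n) :: complex"
  have N: "?N + 1 \<noteq> 0"
    by (metis of_nat_Suc of_nat_neq_0 add.commute)
  \<comment> \<open>The mean state is maximally mixed; it is obtained by contracting second moments
    with the unit trace.\<close>
  have 1: "(\<integral>P. P $ i $ j \<partial>\<mu>) = (if i = j then 1 / ?N else 0)" for i j
  proof -
    have "(\<integral>P. P $ i $ j \<partial>\<mu>) = (if i = j then 1 else 0) * (?N + 1) / (?N * (?N + 1))"
    proof -
      have "moment i j k k = (if i = j then 1 + (if k = j then 1 else 0) else 0) / (?N * (?N + 1))" for k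
        by (auto simp: moment_eq)
      then show ?thesis
        by (simp add: sum.distrib flip: sum_moment sum_divide_distrib)
    qed
    then show ?thesis
      using N by auto
  qed
  have "(\<integral>P. trace (A ** P) \<partial>\<mu>) = (\<Sum>i\<in>UNIV. \<Sum>j\<in>UNIV. A $ i $ j * (\<integral>P. P $ j $ i \<partial>\<mu>))"
    by (simp add: trace_mult_eq_sum integrable_nth)
  also have "\<dots> = trace A / ?N"
    by (simp add: 1 trace_def if_distrib[of "\<lambda>x. _ * x"] sum_divide_distrib cong: if_cong)
  finally show ?thesis .
qed

lemma integrable_trace_mult: "integrable \<mu> (\<lambda>P. trace (A ** P))"
  by (simp add: trace_mult_eq_sum integrable_nth)

text \<open>Compression splits the trace into a product of two expectation values, which puts the
  entries of \<open>P\<close> into the index order of \<open>moment\<close>.\<close>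

lemma trace_mult_mult_eq:
  assumes "P \<in> pure_states"
  shows "trace (A ** P ** B ** P) = (\<Sum>i\<in>UNIV. \<Sum>j\<in>UNIV. \<Sum>k\<in>UNIV. \<Sum>l\<in>UNIV.
     (A $ i $ j * B $ k $ l) * (P $ j $ i * P $ l $ k))"
proof -
  have "A ** P ** B ** P = A ** (P ** B ** P)"
    by (simp add: matrix_mul_assoc)
  then have "trace (A ** P ** B ** P) = trace (A ** P) * trace (B ** P)"
    by (simp only: pure_state_compress[OF assms] trace_mult_mat_mult mult.commute)
  then show ?thesis
    unfolding trace_mult_eq_sum[of A] trace_mult_eq_sum[of B] sum_distrib_right
    unfolding sum_distrib_left by (simp add: mult_ac)
qed

lemma integrable_trace_mult_mult: "integrable \<mu> (\<lambda>P. trace (A ** P ** B ** P))"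
  by (subst Bochner_Integration.integrable_cong[OF refl trace_mult_mult_eq])
    (auto simp: space_eq integrable_nth_mult)

text \<open>The parallel index pattern in \<open>moment_eq\<close> produces the product of traces,
  the crossed pattern the trace of the product.\<close>

lemma integral_trace_mult_mult:
  "(\<integral>P. trace (A ** P ** B ** P) \<partial>\<mu>) =
     (trace A * trace B + trace (A ** B)) / (of_nat CARD('n) * (of_nat CARD('n) + 1))"
proof -
  let ?K = "of_nat CARD('n) * (of_nat CARD('n) + 1) :: complex"
  have "(\<integral>P. trace (A ** P ** B ** P) \<partial>\<mu>) = (\<integral>P. (\<Sum>i\<in>UNIV. \<Sum>j\<in>UNIV. \<Sum>k\<in>UNIV. \<Sum>l\<in>UNIV.
     (A $ i $ j * B $ k $ l) * (P $ j $ i * P $ l $ k)) \<partial>\<mu>)"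
    by (rule Bochner_Integration.integral_cong) (auto simp: space_eq trace_mult_mult_eq)
  also have "\<dots> = (\<Sum>i\<in>UNIV. \<Sum>j\<in>UNIV. \<Sum>k\<in>UNIV. \<Sum>l\<in>UNIV. (A $ i $ j * B $ k $ l) * moment j i l k)"
    by (simp add: moment_def integrable_nth_mult)
  also have "\<dots> = ((\<Sum>i\<in>UNIV. \<Sum>j\<in>UNIV. \<Sum>k\<in>UNIV. \<Sum>l\<in>UNIV.
       if j = i then if l = k then A $ i $ j * B $ k $ l else 0 else 0)
     + (\<Sum>i\<in>UNIV. \<Sum>j\<in>UNIV. \<Sum>k\<in>UNIV. \<Sum>l\<in>UNIV.
       if k = j then if l = i then A $ i $ j * B $ k $ l else 0 else 0)) / ?K"
    unfolding sum.distrib[symmetric] sum_divide_distrib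
    by (intro sum.cong refl) (auto simp: moment_eq add_divide_distrib)
  also have "(\<Sum>i\<in>UNIV. \<Sum>j\<in>UNIV. \<Sum>k\<in>UNIV. \<Sum>l\<in>UNIV.
       if j = i then if l = k then A $ i $ j * B $ k $ l else 0 else 0) = trace A * trace B"
  proof -
    have "(\<Sum>i\<in>UNIV. \<Sum>j\<in>UNIV. \<Sum>k\<in>UNIV. \<Sum>l\<in>UNIV.
       if j = i then if l = k then A $ i $ j * B $ k $ l else 0 else 0)
       = (\<Sum>i\<in>UNIV. \<Sum>j\<in>UNIV. if j = i then (\<Sum>k\<in>UNIV. A $ i $ j * B $ k $ k) else 0)"
      by (intro sum.cong refl) simp
    then show ?thesis
      by (simp add: trace_def sum_product)
  qed
  also have "(\<Sum>i\<in>UNIV. \<Sum>j\<in>UNIV. \<Sum>k\<in>UNIV. \<Sum>l\<in>UNIV.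
       if k = j then if l = i then A $ i $ j * B $ k $ l else 0 else 0) = trace (A ** B)"
  proof -
    have "(\<Sum>i\<in>UNIV. \<Sum>j\<in>UNIV. \<Sum>k\<in>UNIV. \<Sum>l\<in>UNIV.
       if k = j then if l = i then A $ i $ j * B $ k $ l else 0 else 0)
       = (\<Sum>i\<in>UNIV. \<Sum>j\<in>UNIV. \<Sum>k\<in>UNIV. if k = j then A $ i $ j * B $ k $ i else 0)"
      by (intro sum.cong refl) simp
    then show ?thesis
      by (simp add: trace_mult_eq_sum)
  qed
  finally show ?thesis .
qed

end

section \<open>The average\<close>

text \<open>Up to normalization the trace is the overlap with \<open>\<sigma> 0\<close>, so
  orthonormality decides it.\<close>

lemma trace_hermitian_basis:
  fixes \<sigma> :: "nat \<Rightarrow> 'n::finite cmatrix"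
  assumes "hermitian_basis \<sigma>" "i < CARD('n)\<^sup>2"
  shows "trace (\<sigma> i) = (if i = 0 then of_real (sqrt (real CARD('n))) else 0)"
proof -
  have "\<forall>i<CARD('n)\<^sup>2. \<forall>j<CARD('n)\<^sup>2. trace (\<sigma> i ** \<sigma> j) = (if i = j then 1 else 0)"
    using assms(1) unfolding hermitian_basis_def by blast
  from this[rule_format, of 0 i] assms(2)
  have "trace (\<sigma> 0 ** \<sigma> i) = (if i = 0 then 1 else 0)"
    by (simp add: eq_commute[of 0 i])
  moreover have "trace (\<sigma> 0 ** \<sigma> i) = of_real (1 / sqrt (real CARD('n))) * trace (\<sigma> i)"
  proof -
    have "\<sigma> 0 ** \<sigma> i = (1 / sqrt (real CARD('n))) *\<^sub>R \<sigma> i"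
      using assms by (simp add: hermitian_basis_def matrix_scaleR_left)
    then show ?thesis
      by (simp add: trace_def scaleR_conv_of_real[where 'a=complex] sum_divide_distrib)
  qed
  ultimately show ?thesis
    by (auto simp: field_simps split: if_splits)
qed

lemma trace_mult_eq_tau:
  fixes \<sigma> :: "nat \<Rightarrow> 'n::finite cmatrix"
  assumes "hermitian_basis \<sigma>"
  shows "trace (\<sigma> c ** \<rho>) = of_real (sqrt (real CARD('n))) * tau \<sigma> \<rho> c 0"
    and "trace (\<sigma> c ** \<rho>) = of_real (sqrt (real CARD('n))) * tau \<sigma> \<rho> 0 c"
proof -
  have "\<sigma> c ** \<sigma> 0 ** \<rho> = (1 / sqrt (real CARD('n))) *\<^sub>R (\<sigma> c ** \<rho>)"
    "\<sigma> 0 ** \<sigma> c ** \<rho> = (1 / sqrt (real CARD('n))) *\<^sub>R (\<sigma> c ** \<rho>)"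
    using assms by (simp_all add: hermitian_basis_def matrix_scaleR_left matrix_scaleR_right)
  then show "trace (\<sigma> c ** \<rho>) = of_real (sqrt (real CARD('n))) * tau \<sigma> \<rho> c 0"
    "trace (\<sigma> c ** \<rho>) = of_real (sqrt (real CARD('n))) * tau \<sigma> \<rho> 0 c"
    by (simp_all add: tau_def trace_def scaleR_conv_of_real[where 'a=complex]
        flip: sum_divide_distrib)
qed

text \<open>For distinct indices every trace term vanishes. For equal positive ones the two averages
  differ by exactly \<open>nu\<close>; at index 0 the squared trace N makes them cancel.\<close>

lemma (in uniform_pure_states) integral_basis_pair:
  assumes \<sigma>: "hermitian_basis \<sigma>" and i: "i < CARD('n)\<^sup>2" and j: "j < CARD('n)\<^sup>2"
  shows "(\<integral>P. trace (\<sigma> i ** \<sigma> j ** P) - trace (\<sigma> i ** P ** \<sigma> j ** P) \<partial>\<mu>) =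
    (if i = j \<and> 0 < i then of_real (nu CARD('n)) else 0)"
proof -
  let ?N = "of_nat CARD('n) :: complex"
  have N: "?N + 1 \<noteq> 0" "?N \<noteq> 0"
    by (metis of_nat_Suc of_nat_neq_0 add.commute) simp
  have sq: "complex_of_real (sqrt (real CARD('n))) * of_real (sqrt (real CARD('n))) = ?N"
    by (simp flip: of_real_mult)
  have "(\<integral>P. trace (\<sigma> i ** \<sigma> j ** P) - trace (\<sigma> i ** P ** \<sigma> j ** P) \<partial>\<mu>)
     = trace (\<sigma> i ** \<sigma> j) / ?N - (trace (\<sigma> i) * trace (\<sigma> j) + trace (\<sigma> i ** \<sigma> j)) / (?N * (?N + 1))"
    by (simp add: integrable_trace_mult integrable_trace_mult_mult integral_trace_mult
        integral_trace_mult_mult)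
  also have "trace (\<sigma> i ** \<sigma> j) = (if i = j then 1 else 0)"
    using assms by (simp add: hermitian_basis_def)
  also have "trace (\<sigma> i) * trace (\<sigma> j) = (if i = j \<and> i = 0 then ?N else 0)"
    using sq by (simp add: trace_hermitian_basis assms)
  finally show ?thesis
    using N by (auto simp: nu_def)
qed

lemma trace_kron_sum_mult:
  fixes A :: "'j \<Rightarrow> 'w::finite cmatrix" and B :: "'k \<Rightarrow> 'e::finite cmatrix"
    and J :: "'j set" and K :: "'k set"
  defines "G g \<equiv> (\<Sum>j\<in>J. \<Sum>k\<in>K. mat (g j k) ** (A j \<otimes>\<^sub>k B k))"
  shows "trace (G f ** (C \<otimes>\<^sub>k D)) = (\<Sum>j\<in>J. \<Sum>k\<in>K. f j k * (trace (A j ** C) * trace (B k ** D)))"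
    and "trace (G f ** G g ** (C \<otimes>\<^sub>k D)) = (\<Sum>b\<in>J. \<Sum>c\<in>K. \<Sum>j\<in>J. \<Sum>k\<in>K.
      f b c * g j k * (trace (A b ** A j ** C) * trace (B c ** B k ** D)))"
proof -
  have "G g ** (C \<otimes>\<^sub>k D) = (\<Sum>j\<in>J. \<Sum>k\<in>K. mat (g j k) ** ((A j ** C) \<otimes>\<^sub>k (B k ** D)))" for g C D
    by (simp add: G_def matrix_sum_rdistrib kron_mult flip: matrix_mul_assoc)
  then show "trace (G f ** (C \<otimes>\<^sub>k D)) = (\<Sum>j\<in>J. \<Sum>k\<in>K. f j k * (trace (A j ** C) * trace (B k ** D)))"
    by (simp add: trace_sum trace_mat_mult trace_kron)
  have GG: "G f ** G g = (\<Sum>b\<in>J. \<Sum>c\<in>K. \<Sum>j\<in>J. \<Sum>k\<in>K.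
      mat (f b c * g j k) ** ((A b ** A j) \<otimes>\<^sub>k (B c ** B k)))"
    unfolding G_def matrix_sum_rdistrib
    by (simp add: matrix_sum_ldistrib mat_mult_mult_mat_mult kron_mult)
  have "mat x ** (Y \<otimes>\<^sub>k Z) ** (C \<otimes>\<^sub>k D) = mat x ** ((Y ** C) \<otimes>\<^sub>k (Z ** D))" for x Y Z
    by (simp add: kron_mult flip: matrix_mul_assoc)
  then show "trace (G f ** G g ** (C \<otimes>\<^sub>k D)) = (\<Sum>b\<in>J. \<Sum>c\<in>K. \<Sum>j\<in>J. \<Sum>k\<in>K.
      f b c * g j k * (trace (A b ** A j ** C) * trace (B c ** B k ** D)))"
    by (simp add: GG matrix_sum_rdistrib trace_sum trace_mat_mult trace_kron)
qed

theorem proposition3: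
  fixes \<sigma>l :: "nat \<Rightarrow> complex^'l::finite^'l"
    and \<sigma>w :: "nat \<Rightarrow> complex^'w::finite^'w"
    and \<sigma>e :: "nat \<Rightarrow> complex^'e::finite^'e"
    and H :: "complex^('l \<times> 'w \<times> 'e)^('l \<times> 'w \<times> 'e)"
    and M :: nat
    and L :: "nat \<Rightarrow> complex^'e^'e"
    and \<rho>w :: "complex^'w^'w"
    and \<rho>e :: "complex^'e^'e"
    and \<rho> :: "complex^'l^'l \<Rightarrow> real \<Rightarrow> complex^('l \<times> 'w \<times> 'e)^('l \<times> 'w \<times> 'e)"
    and \<mu> :: "(complex^'l^'l) measure"
  assumes "hermitian_basis \<sigma>l" and "hermitian_basis \<sigma>w" and "hermitian_basis \<sigma>e"
    and "hermitian H"
    and "density_matrix \<rho>w" and "density_matrix \<rho>e"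
    and "\<And>\<rho>l. \<rho>l \<in> pure_states \<Longrightarrow> \<rho> \<rho>l 0 = \<rho>l \<otimes>\<^sub>k \<rho>w \<otimes>\<^sub>k \<rho>e"
    and "\<And>\<rho>l. \<rho>l \<in> pure_states \<Longrightarrow>
           lindblad_solution H M (\<lambda>m. mat 1 \<otimes>\<^sub>k mat 1 \<otimes>\<^sub>k L m) (\<rho> \<rho>l)"
    and "uniform_on_pure_states \<mu>"
  shows "(\<integral>\<rho>l. initial_second_derivative (\<lambda>t. purity (\<rho> \<rho>l t)) \<partial>\<mu>) =
    4 * complex_of_real (nu CARD('l)) *
      (\<Sum>i\<in>{1..<CARD('l)\<^sup>2}. \<Sum>b<CARD('w)\<^sup>2. \<Sum>c<CARD('e)\<^sup>2. \<Sum>j<CARD('w)\<^sup>2. \<Sum>k<CARD('e)\<^sup>2.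
         coupling \<sigma>l \<sigma>w \<sigma>e H i b c * coupling \<sigma>l \<sigma>w \<sigma>e H i j k *
         (of_nat CARD('e) * tau \<sigma>e \<rho>e c 0 * tau \<sigma>e \<rho>e 0 k *
            trace (\<sigma>w b ** \<rho>w) * trace (\<sigma>w j ** \<rho>w)
          - tau \<sigma>e \<rho>e c k * trace (\<sigma>w b ** \<sigma>w j ** \<rho>w)))"
proof -
  interpret uniform_pure_states \<mu>
    by unfold_locales (rule assms)
  let ?I = "{..<CARD('l)\<^sup>2}" and ?J = "{..<CARD('w)\<^sup>2}" and ?K = "{..<CARD('e)\<^sup>2}"
  define g where "g = coupling \<sigma>l \<sigma>w \<sigma>e H"
  define X where "X = \<rho>w \<otimes>\<^sub>k \<rho>e"
  define G where "G i = (\<Sum>j\<in>?J. \<Sum>k\<in>?K. mat (g i j k) ** (\<sigma>w j \<otimes>\<^sub>k \<sigma>e k))" for i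
  \<comment> \<open>Minus the covariance of \<open>G i\<close> and \<open>G j\<close> in the state
    \<open>X\<close>; it does not depend on the averaged state.\<close>
  define Y where "Y i j = trace (G i ** X) * trace (G j ** X) - trace (G i ** G j ** X)" for i j
  have H: "H = (\<Sum>i\<in>?I. \<sigma>l i \<otimes>\<^sub>k G i)"
    unfolding G_def g_def by (intro kron_expansion hermitian_basis_complete assms)
  have X: "trace X = 1"
    using assms(5,6) by (simp add: X_def trace_kron density_matrix_def)
  have rate: "initial_second_derivative (\<lambda>t. purity (\<rho> P t)) = 4 * (\<Sum>i\<in>?I. \<Sum>j\<in>?I.
      (trace (\<sigma>l i ** \<sigma>l j ** P) - trace (\<sigma>l i ** P ** \<sigma>l j ** P)) * Y i j)"
    if P: "P \<in> pure_states" for P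
    unfolding Y_def purity_rate_expansion[OF H, symmetric]
    \<comment> \<open>All that is traced out counts as one factor, on which the noise acts by
      \<open>mat 1 \<otimes>\<^sub>k L m\<close>.\<close>
    by (rule initial_second_derivative_purity[where K="\<lambda>m. mat 1 \<otimes>\<^sub>k L m", OF assms(8)[OF P]
          assms(7)[OF P, folded X_def] pure_state_idempotent[OF P] X])
  have "(\<integral>P. initial_second_derivative (\<lambda>t. purity (\<rho> P t)) \<partial>\<mu>)
    = (\<integral>P. 4 * (\<Sum>i\<in>?I. \<Sum>j\<in>?I.
      (trace (\<sigma>l i ** \<sigma>l j ** P) - trace (\<sigma>l i ** P ** \<sigma>l j ** P)) * Y i j) \<partial>\<mu>)"
    by (rule Bochner_Integration.integral_cong) (simp_all add: space_eq rate)
  also have "\<dots> = 4 * (\<Sum>i\<in>?I. \<Sum>j\<in>?I.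
      (\<integral>P. trace (\<sigma>l i ** \<sigma>l j ** P) - trace (\<sigma>l i ** P ** \<sigma>l j ** P) \<partial>\<mu>) * Y i j)"
    by (simp add: integrable_trace_mult integrable_trace_mult_mult)
  also have "\<dots> = 4 * (\<Sum>i\<in>?I. \<Sum>j\<in>?I. if i = j then if 0 < i then of_real (nu CARD('l)) * Y i j else 0 else 0)"
    by (intro arg_cong2[where f="(*)"] refl sum.cong) (simp add: integral_basis_pair[OF assms(1)])
  also have "\<dots> = 4 * (\<Sum>i\<in>?I. if 0 < i then of_real (nu CARD('l)) * Y i i else 0)"
    by simp
  also have "\<dots> = 4 * (\<Sum>i\<in>{1..<CARD('l)\<^sup>2}. of_real (nu CARD('l)) * Y i i)"
    by (intro arg_cong2[where f="(*)"] refl sum.mono_neutral_cong_right) auto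
  also have "\<dots> = 4 * complex_of_real (nu CARD('l)) * (\<Sum>i\<in>{1..<CARD('l)\<^sup>2}. Y i i)"
    by (simp add: sum_distrib_left mult.assoc)
  also have "(\<Sum>i\<in>{1..<CARD('l)\<^sup>2}. Y i i) = (\<Sum>i\<in>{1..<CARD('l)\<^sup>2}. \<Sum>b\<in>?J. \<Sum>c\<in>?K. \<Sum>j\<in>?J. \<Sum>k\<in>?K.
      g i b c * g i j k * (of_nat CARD('e) * tau \<sigma>e \<rho>e c 0 * tau \<sigma>e \<rho>e 0 k *
            trace (\<sigma>w b ** \<rho>w) * trace (\<sigma>w j ** \<rho>w)
          - tau \<sigma>e \<rho>e c k * trace (\<sigma>w b ** \<sigma>w j ** \<rho>w)))"
  proof (rule sum.cong[OF refl])
    fix i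
    let ?s = "complex_of_real (sqrt (real CARD('e)))"
    have s: "?s * ?s = of_nat CARD('e)"
      by (simp flip: of_real_mult)
    \<comment> \<open>Each environment mean is a \<open>tau\<close> with one index 0 times the root
      of the dimension, as \<open>\<sigma>e 0\<close> is normalized; the two roots multiply to the
      factor \<open>of_nat CARD('e)\<close>.\<close>
    have "trace (G i ** X) * trace (G i ** X)
      = (\<Sum>b\<in>?J. \<Sum>c\<in>?K. g i b c * (trace (\<sigma>w b ** \<rho>w) * (?s * tau \<sigma>e \<rho>e c 0))) *
        (\<Sum>j\<in>?J. \<Sum>k\<in>?K. g i j k * (trace (\<sigma>w j ** \<rho>w) * (?s * tau \<sigma>e \<rho>e 0 k)))"
      by (simp add: G_def X_def trace_kron_sum_mult flip: trace_mult_eq_tau[OF assms(3)])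
    also have "\<dots> = (\<Sum>b\<in>?J. \<Sum>c\<in>?K. \<Sum>j\<in>?J. \<Sum>k\<in>?K. g i b c * g i j k *
        ((?s * ?s) * tau \<sigma>e \<rho>e c 0 * tau \<sigma>e \<rho>e 0 k * trace (\<sigma>w b ** \<rho>w) * trace (\<sigma>w j ** \<rho>w)))"
      unfolding sum_distrib_right unfolding sum_distrib_left by (simp only: mult_ac)
    finally show "Y i i = (\<Sum>b\<in>?J. \<Sum>c\<in>?K. \<Sum>j\<in>?J. \<Sum>k\<in>?K.
      g i b c * g i j k * (of_nat CARD('e) * tau \<sigma>e \<rho>e c 0 * tau \<sigma>e \<rho>e 0 k *
            trace (\<sigma>w b ** \<rho>w) * trace (\<sigma>w j ** \<rho>w)
          - tau \<sigma>e \<rho>e c k * trace (\<sigma>w b ** \<sigma>w j ** \<rho>w)))"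
      unfolding Y_def s right_diff_distrib sum_subtractf
      by (simp add: G_def X_def trace_kron_sum_mult(2) tau_def mult.commute)
  qed
  finally show ?thesis
    by (simp add: g_def)
qed

end
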